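(* For every real $R$ with $1\le R<2$ and every $\epsilon>0$, the competitive ratio of the proportional\&removable online knapsack problem with a buffer of capacity $R$ is at least $\frac{1+\sqrt{4R+1}}{2R}-\epsilon$.
   Context: Online knapsack problem with a resource buffer: there is a knapsack of capacity $1$ and a buffer of capacity $R\ge 1$. Items $e_1,\dots,e_n$ arrive one by one; each item $e$ has size $0<s(e)\le 1$ and value $v(e)\ge 0$; $s(B),v(B)$ denote sums over a set $B$. A deterministic online algorithm maintains buffer contents $B_0=\emptyset,B_1,\dots,B_n$, with $B_i$ chosen after seeing only $e_1,\dots,e_i$, $B_i\subseteq B_{i-1}\cup\{e_i\}$ and $s(B_i)\le R$ (removable setting). $\mathrm{ALG}(I)=\max\{v(B)\mid B\subseteq B_n,\ s(B)\le 1\}$, $\mathrm{OPT}(I)=\max\{v(B)\mid B\subseteq\{e_1,\dots,e_n\},\ s(B)\le 1\}$. "Proportional" means $v(e)=s(e)$ for every item. The competitive ratio of an algorithm is $\sup_I \mathrm{OPT}(I)/\mathrm{ALG}(I)$ (with $a/0=\infty$ for $a>0$), and the competitive ratio of the problem is the infimum of this over all deterministic online algorithms. *)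

theory Defs
  imports "HOL-Library.Extended_Real"
begin

record item =
  item_size :: real
  item_value :: real

text \<open>
  An instance is the list of items in order of arrival. Sets of items are represented by
  sets of positions in this list, so that several items may have the same size and value.
\<close>

definition valid_item :: "item \<Rightarrow> bool" where
  "valid_item e \<longleftrightarrow> 0 < item_size e \<and> item_size e \<le> 1 \<and> 0 \<le> item_value e"

definition instances :: "item list set" where
  "instances = {I. \<forall>e\<in>set I. valid_item e}"

definition proportional_instances :: "item list set" where
  "proportional_instances = {I \<in> instances. \<forall>e\<in>set I. item_value e = item_size e}"

definition total_size :: "item list \<Rightarrow> nat set \<Rightarrow> real" where
  "total_size I B = (\<Sum>i\<in>B. item_size (I ! i))"

definition total_value :: "item list \<Rightarrow> nat set \<Rightarrow> real" where
  "total_value I B = (\<Sum>i\<in>B. item_value (I ! i))"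

definition best_packing :: "item list \<Rightarrow> nat set \<Rightarrow> real" where
  "best_packing I S = Max {total_value I B | B. B \<subseteq> S \<and> total_size I B \<le> 1}"

definition OPT :: "item list \<Rightarrow> real" where
  "OPT I = best_packing I {..<length I}"

text \<open>
  A deterministic online algorithm is a function \<open>A\<close> from the items seen so far to the current
  buffer contents: on \<open>e\<^sub>1, \<dots>, e\<^sub>n\<close> it produces \<open>B\<^sub>i = A [e\<^sub>1, \<dots>, e\<^sub>i]\<close>. The position of the item
  arriving after the list \<open>I\<close> is \<open>length I\<close>. The constraints are imposed only on the class \<open>D\<close> of
  admissible instances, which is assumed to be closed under prefixes.
\<close>

definition removable_online_algorithm ::
  "real \<Rightarrow> item list set \<Rightarrow> (item list \<Rightarrow> nat set) \<Rightarrow> bool" where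
  "removable_online_algorithm R D A \<longleftrightarrow>
     A [] = {} \<and>
     (\<forall>I e. I @ [e] \<in> D \<longrightarrow> A (I @ [e]) \<subseteq> A I \<union> {length I}) \<and>
     (\<forall>I\<in>D. total_size I (A I) \<le> R)"

definition ALG :: "(item list \<Rightarrow> nat set) \<Rightarrow> item list \<Rightarrow> real" where
  "ALG A I = best_packing I (A I)"

text \<open>
  Division on \<^typ>\<open>ereal\<close> satisfies \<open>a / 0 = \<infinity>\<close> for \<open>a > 0\<close>, and \<open>0 / 0 = 0\<close>, so instances with
  \<open>OPT I = 0\<close> do not contribute to the supremum.
\<close>

definition algorithm_competitive_ratio ::
  "item list set \<Rightarrow> (item list \<Rightarrow> nat set) \<Rightarrow> ereal" where
  "algorithm_competitive_ratio D A = (SUP I\<in>D. ereal (OPT I) / ereal (ALG A I))"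

definition removable_competitive_ratio :: "real \<Rightarrow> item list set \<Rightarrow> ereal" where
  "removable_competitive_ratio R D =
     (INF A\<in>{A. removable_online_algorithm R D A}. algorithm_competitive_ratio D A)"

end

theory Submission
  imports Defs
begin

text \<open>
  Let \<open>y\<close> be the reciprocal of the claimed bound, so that \<open>y + y\<^sup>2 = R\<close>, and let \<open>x\<close> be slightly
  larger than \<open>y\<^sup>2\<close>. The adversary presents items of sizes \<open>x\<close> and \<open>y\<close>, which do not fit into the
  buffer together. An algorithm without \<open>y\<close> has ratio at least \<open>y / x \<approx> 1 / y\<close>. An algorithm
  without \<open>x\<close> next receives an item of size \<open>1 - x\<close>: the optimum becomes \<open>1\<close>, whereas \<open>y\<close> and
  \<open>1 - x\<close> do not fit into the knapsack together and neither exceeds \<open>y\<close>.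
\<close>

lemma best_packing_ge:
  assumes "finite S" "B \<subseteq> S" "total_size I B \<le> 1"
  shows "total_value I B \<le> best_packing I S"
  unfolding best_packing_def using assms by (intro Max_ge) auto

lemma best_packing_le:
  assumes "finite S" and "\<And>B. B \<subseteq> S \<Longrightarrow> total_size I B \<le> 1 \<Longrightarrow> total_value I B \<le> u"
  shows "best_packing I S \<le> u"
proof -
  have "total_value I {} \<in> {total_value I B | B. B \<subseteq> S \<and> total_size I B \<le> 1}"
    by (rule CollectI, rule exI[of _ "{}"]) (simp add: total_size_def)
  then show ?thesis
    unfolding best_packing_def using assms by (subst Max_le_iff) auto
qed

lemma best_packing_nonneg:
  "finite S \<Longrightarrow> 0 \<le> best_packing I S"
  using best_packing_ge[of S "{}" I] by (simp add: total_size_def total_value_def)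

text \<open>The product form \<open>c * b \<le> a\<close> also covers \<open>b = 0\<close>, where
  the quotient is infinite because \<open>a > 0\<close>. An algorithm that packs nothing thus needs
  no separate treatment.\<close>

lemma ereal_le_divide_real:
  fixes a b c :: real
  assumes "0 < a" "0 \<le> b" "c * b \<le> a"
  shows "ereal c \<le> ereal a / ereal b"
  using assms by (cases "b = 0") (auto simp: pos_le_divide_eq)

lemma algorithm_competitive_ratio_ge:
  assumes "I \<in> D" "finite (A I)" "0 < OPT I" "c * ALG A I \<le> OPT I"
  shows "ereal c \<le> algorithm_competitive_ratio D A"
  unfolding algorithm_competitive_ratio_def
  using assms by (intro SUP_upper2[of I] ereal_le_divide_real)
    (simp_all add: ALG_def best_packing_nonneg)

text \<open>The adversary's game for fixed sizes. \<open>R < x + y\<close> forces the loss of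
  \<open>x\<close> or \<open>y\<close>; \<open>c * x \<le> y\<close> and
  \<open>c * y \<le> 1\<close> bound the ratio when \<open>y\<close> or \<open>x\<close> is missing,
  respectively.\<close>

lemma algorithm_competitive_ratio_ge_of_sizes:
  fixes R x y c :: real
  assumes alg: "removable_online_algorithm R proportional_instances A"
    and xy: "0 < x" "x < y" "y \<le> 1" "1 < x + y" "R < x + y"
    and c: "0 \<le> c" "c * x \<le> y" "c * y \<le> 1"
  shows "ereal c \<le> algorithm_competitive_ratio proportional_instances A"
proof -
  define p where "p s = \<lparr>item_size = s, item_value = s\<rparr>" for s :: real
  have p [simp]: "item_size (p s) = s" "item_value (p s) = s" for s
    by (simp_all add: p_def)
  define I where "I = [p x, p y]"
  define J where "J = I @ [p (1 - x)]"
  have inst: "[p x] \<in> proportional_instances" "I \<in> proportional_instances"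
      "J \<in> proportional_instances"
    using xy by (auto simp: proportional_instances_def instances_def valid_item_def I_def J_def)
  have step: "A (K @ [e]) \<subseteq> A K \<union> {length K}" if "K @ [e] \<in> proportional_instances" for K e
    using alg that by (simp add: removable_online_algorithm_def)
  have "A [p x] \<subseteq> {0}"
    using alg step[of "[]" "p x"] inst by (simp add: removable_online_algorithm_def)
  then have AI: "A I \<subseteq> {0, 1}"
    using step[of "[p x]" "p y"] inst by (auto simp: I_def)
  have finI: "finite (A I)"
    using AI by (rule finite_subset) simp
  have sizeI: "total_size I (A I) \<le> R"
    using alg inst by (simp add: removable_online_algorithm_def)
  have AJ: "A J \<subseteq> A I \<union> {2}"
    using step[of I "p (1 - x)"] inst by (simp add: J_def I_def numeral_2_eq_2)
  have finJ: "finite (A J)"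
    using AJ by (rule finite_subset) (simp add: finI)
  show ?thesis
  proof (cases "1 \<in> A I")
    case False
    then have AI0: "A I \<subseteq> {0}"
      using AI by auto
    have "ALG A I \<le> x"
      unfolding ALG_def
    proof (rule best_packing_le[OF finI])
      fix B assume "B \<subseteq> A I"
      then have "B = {} \<or> B = {0}"
        using AI0 by auto
      then show "total_value I B \<le> x"
        using xy by (auto simp: total_value_def I_def)
    qed
    moreover have "y \<le> OPT I"
      using best_packing_ge[of "{..<length I}" "{1}" I] xy
      by (simp add: OPT_def total_size_def total_value_def I_def)
    ultimately show ?thesis
      using xy c mult_left_mono[of "ALG A I" x c]
      by (intro algorithm_competitive_ratio_ge[of I]) (auto simp: inst finI)
  next
    case True
    have "0 \<notin> A I"
    proof
      assume "0 \<in> A I"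
      then have "A I = {0, 1}"
        using AI True by auto
      then show False
        using sizeI xy by (simp add: total_size_def I_def)
    qed
    then have AJ12: "A J \<subseteq> {1, 2}"
      using AI AJ by auto
    \<comment> \<open>A packing of both positions 1 and 2 would have size
      \<open>y + (1 - x) > 1\<close>, by \<open>x < y\<close>; position 2 alone is worth
      \<open>1 - x < y\<close>, by \<open>1 < x + y\<close>.\<close>
    have "ALG A J \<le> y"
      unfolding ALG_def
    proof (rule best_packing_le[OF finJ])
      fix B assume "B \<subseteq> A J" and small: "total_size J B \<le> 1"
      then have "B = {} \<or> B = {1} \<or> B = {2} \<or> B = {1, 2}"
        using AJ12 by auto
      then show "total_value J B \<le> y"
        using xy small by (auto simp: total_value_def total_size_def I_def J_def)
    qed
    \<comment> \<open>The discarded \<open>x\<close> and the last item \<open>1 - x\<close> fill the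
      knapsack exactly.\<close>
    moreover have "1 \<le> OPT J"
      using best_packing_ge[of "{..<length J}" "{0, 2}" J]
      by (simp add: OPT_def total_size_def total_value_def I_def J_def)
    ultimately show ?thesis
      using xy c mult_left_mono[of "ALG A J" y c]
      by (intro algorithm_competitive_ratio_ge[of J]) (auto simp: inst finJ)
  qed
qed

theorem theorem10:
  fixes R \<epsilon> :: real
  assumes "1 \<le> R" and "R < 2" and "\<epsilon> > 0"
  shows "removable_competitive_ratio R proportional_instances
           \<ge> ereal ((1 + sqrt (4 * R + 1)) / (2 * R) - \<epsilon>)"
proof -
  define s where "s = sqrt (4 * R + 1)"
  \<comment> \<open>The positive root of \<open>y + y * y = R\<close>; its reciprocal is the claimed
    bound because \<open>(s - 1) * (s + 1) = 4 * R\<close>.\<close>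
  define y where "y = (s - 1) / 2"
  \<comment> \<open>Truncation at 0 keeps \<open>c\<close> nonnegative for large
    \<open>\<epsilon>\<close>, so that upper bounds on \<open>ALG\<close> may be multiplied by
    it.\<close>
  define c where "c = max 0 (1 / y - \<epsilon>)"
  have s2: "s * s = 4 * R + 1"
    using assms by (simp add: s_def)
  have "1 < s"
    unfolding s_def using assms by (intro real_less_rsqrt) simp
  moreover have "s < 3"
    unfolding s_def using assms by (intro real_less_lsqrt) simp_all
  ultimately have y: "0 < y" "y < 1"
    by (simp_all add: y_def)
  have R: "y + y * y = R"
    using s2 by (simp add: y_def field_simps)
  have "1 / y = (1 + s) / (2 * R)"
    using s2 y assms by (simp add: y_def field_simps)
  then have bound: "(1 + sqrt (4 * R + 1)) / (2 * R) - \<epsilon> \<le> c"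
    by (simp add: c_def s_def)
  have "c * y \<le> 1"
    using y assms by (simp add: c_def max_def field_simps)
  have "c < 1 / y"
    using y assms by (simp add: c_def)
  \<comment> \<open>Room for \<open>x\<close>: above \<open>y * y\<close>, so that
    \<open>x + y > R\<close>, yet below \<open>y / c\<close>, so that \<open>c * x \<le> y\<close>.
    The gap exists because \<open>\<epsilon>\<close> keeps \<open>c\<close> strictly below
    \<open>1 / y\<close>.\<close>
  have "y * y < min y (y / c)" if "0 < c"
    using that y \<open>c < 1 / y\<close> by (simp add: field_simps)
  moreover have "y * y < y"
    using y by simp
  ultimately obtain x where x: "y * y < x" "x < y" "0 < c \<Longrightarrow> x < y / c"
    by (metis dense min_less_iff_conj)
  have cx: "c * x \<le> y"
  proof (cases "0 < c")
    case True
    then show ?thesis using x(3) by (simp add: field_simps)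
  next
    case False
    then show ?thesis using y by (simp add: c_def)
  qed
  have "0 < x"
    using x(1) y by (meson mult_pos_pos less_trans)
  have "ereal c \<le> removable_competitive_ratio R proportional_instances"
    unfolding removable_competitive_ratio_def
  proof (rule INF_greatest)
    fix A assume "A \<in> {A. removable_online_algorithm R proportional_instances A}"
    then show "ereal c \<le> algorithm_competitive_ratio proportional_instances A"
      using algorithm_competitive_ratio_ge_of_sizes[of R A x y c]
        x y R cx \<open>0 < x\<close> \<open>c * y \<le> 1\<close> assms by (simp add: c_def)
  qed
  then show ?thesis
    using bound by (meson ereal_less_eq(3) order_trans)
qed

end
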